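(* A generic compact metric space is totally discontinuous: the set of (isometry classes of) compact metric spaces $X\in\mathfrak{M}$ such that every connected component of $X$ is a single point is a residual subset of the Gromov-Hausdorff space $(\mathfrak{M},d_{GH})$.
   Context: $\mathfrak{M}$ denotes the Gromov-Hausdorff space: the set of all nonempty compact metric spaces up to isometry, endowed with the Gromov-Hausdorff distance $d_{GH}(X,Y)=\inf d_H^Z(f(X),g(Y))$, where the infimum is over all metric spaces $Z$ and all isometric injections $f:X\to Z$, $g:Y\to Z$, and $d_H^Z$ is the Hausdorff distance between subsets of $Z$. The metric space $\mathfrak{M}$ is complete, hence a Baire space. A subset is rare if its closure has empty interior, meager if it is a countable union of rare sets, and residual if its complement is meager. "A generic compact metric space has property $P$" means that the set of $X\in\mathfrak{M}$ having $P$ is residual in $\mathfrak{M}$. *)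

theory Defs
  imports "HOL-Analysis.Analysis"
begin

section \<open>The Gromov-Hausdorff distance\<close>

definition compact_metric :: "'a metric \<Rightarrow> bool" where
  "compact_metric X \<longleftrightarrow> mspace X \<noteq> {} \<and> compact_space (mtopology_of X)"

definition isometric :: "'a metric \<Rightarrow> 'b metric \<Rightarrow> bool" where
  "isometric X Y \<longleftrightarrow>
     (\<exists>f. f ` mspace X = mspace Y \<and>
          (\<forall>x\<in>mspace X. \<forall>x'\<in>mspace X. mdist Y (f x) (f x') = mdist X x x'))"

definition isometric_injection :: "'a metric \<Rightarrow> 'b metric \<Rightarrow> ('a \<Rightarrow> 'b) \<Rightarrow> bool" where
  "isometric_injection X Z f \<longleftrightarrow>
     f \<in> mspace X \<rightarrow> mspace Z \<and>
     (\<forall>x\<in>mspace X. \<forall>x'\<in>mspace X. mdist Z (f x) (f x') = mdist X x x')"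

text \<open>
  The infimum is over a nonempty set, hence meaningful, when \<open>A\<close> and \<open>B\<close> are
  nonempty and bounded.
\<close>

definition hausdorff_dist :: "'a metric \<Rightarrow> 'a set \<Rightarrow> 'a set \<Rightarrow> real" where
  "hausdorff_dist Z A B =
     Inf {r. 0 < r \<and> (\<forall>a\<in>A. \<exists>b\<in>B. mdist Z a b < r) \<and> (\<forall>b\<in>B. \<exists>a\<in>A. mdist Z a b < r)}"

text \<open>
  HOL has no type of all metric spaces. A compact metric space has at most continuum many points,
  so up to isometry its underlying set is a set of reals (\<open>ex_isometric_real_metric\<close>
  below); these points are mere labels, and the metric on them is arbitrary. Likewise an ambient
  space may be cut down to the union of the two images, so it suffices to let it range over the
  metric spaces whose points are reals; \<open>GH_distance_le\<close> below shows that ambient spaces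
  over other types do not lower the infimum.
\<close>

definition GH_distance :: "real metric \<Rightarrow> real metric \<Rightarrow> real" where
  "GH_distance X Y =
     Inf {hausdorff_dist Z (f ` mspace X) (g ` mspace Y) | (Z :: real metric) f g.
            isometric_injection X Z f \<and> isometric_injection Y Z g}"


subsection \<open>Isometries\<close>

lemma isometric_refl: "isometric X X"
  unfolding isometric_def by (intro exI[of _ id]) auto

lemma isometric_sym:
  assumes "isometric X Y"
  shows "isometric Y X"
proof -
  obtain f where f: "f ` mspace X = mspace Y"
    and d: "\<And>x x'. x \<in> mspace X \<Longrightarrow> x' \<in> mspace X \<Longrightarrow> mdist Y (f x) (f x') = mdist X x x'"
    using assms unfolding isometric_def by blast
  let ?g = "inv_into (mspace X) f"
  have "inj_on f (mspace X)"
    by (metis d inj_onI mdist_zero)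
  then have "?g ` mspace Y = mspace X"
    using f by (metis inv_into_image_cancel order_refl)
  moreover have "mdist X (?g y) (?g y') = mdist Y y y'" if "y \<in> mspace Y" "y' \<in> mspace Y" for y y'
    using that f d[of "?g y" "?g y'"] by (simp add: inv_into_into f_inv_into_f)
  ultimately show ?thesis
    unfolding isometric_def by blast
qed

lemma isometric_trans:
  assumes "isometric X Y" "isometric Y Z"
  shows "isometric X Z"
proof -
  obtain f where f: "f ` mspace X = mspace Y"
      "\<forall>x\<in>mspace X. \<forall>x'\<in>mspace X. mdist Y (f x) (f x') = mdist X x x'"
    using assms(1) unfolding isometric_def by blast
  obtain g where g: "g ` mspace Y = mspace Z"
      "\<forall>x\<in>mspace Y. \<forall>x'\<in>mspace Y. mdist Z (g x) (g x') = mdist Y x x'"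
    using assms(2) unfolding isometric_def by blast
  have "(g \<circ> f) ` mspace X = mspace Z"
    using f g by (simp flip: image_image add: image_comp[symmetric])
  moreover have "\<forall>x\<in>mspace X. \<forall>x'\<in>mspace X. mdist Z ((g \<circ> f) x) ((g \<circ> f) x') = mdist X x x'"
    using f g by (metis comp_apply imageI)
  ultimately show ?thesis
    unfolding isometric_def by blast
qed

lemma isometric_imp_homeomorphic_map:
  assumes "f ` mspace X = mspace Y"
    and "\<And>x x'. x \<in> mspace X \<Longrightarrow> x' \<in> mspace X \<Longrightarrow> mdist Y (f x) (f x') = mdist X x x'"
  shows "homeomorphic_map (mtopology_of X) (mtopology_of Y) f"
  using Metric_space12.isometry_imp_homeomorphic_map[OF Metric_space12_mspace_mdist, of f X Y] assms
  by (simp add: mtopology_of_def)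

lemma compact_metric_isometric:
  assumes "compact_metric X" "isometric X Y"
  shows "compact_metric Y"
proof -
  obtain f where f: "f ` mspace X = mspace Y"
      "\<And>x x'. x \<in> mspace X \<Longrightarrow> x' \<in> mspace X \<Longrightarrow> mdist Y (f x) (f x') = mdist X x x'"
    using assms(2) unfolding isometric_def by blast
  have "mtopology_of X homeomorphic_space mtopology_of Y"
    using isometric_imp_homeomorphic_map[OF f] homeomorphic_map_imp_homeomorphic_space by blast
  then show ?thesis
    using assms(1) f(1) homeomorphic_compact_space unfolding compact_metric_def by fastforce
qed

text \<open>Transport of a metric along an injection of its points into another type.\<close>

lemma metric_transport:
  fixes X :: "'a metric" and h :: "'a \<Rightarrow> 'b"
  assumes h: "inj_on h (mspace X)"
  obtains Y :: "'b metric" where "mspace Y = h ` mspace X"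
    and "\<And>x x'. x \<in> mspace X \<Longrightarrow> x' \<in> mspace X \<Longrightarrow> mdist Y (h x) (h x') = mdist X x x'"
proof -
  let ?k = "inv_into (mspace X) h"
  let ?d = "\<lambda>u v. mdist X (?k u) (?k v)"
  have M: "Metric_space (h ` mspace X) ?d"
  proof
    show "?d u v = 0 \<longleftrightarrow> u = v" if "u \<in> h ` mspace X" "v \<in> h ` mspace X" for u v
      using that h by (auto simp: inv_into_f_f)
    show "?d u w \<le> ?d u v + ?d v w"
      if "u \<in> h ` mspace X" "v \<in> h ` mspace X" "w \<in> h ` mspace X" for u v w
      using that by (intro mdist_triangle) (auto intro: inv_into_into)
  qed (auto simp: mdist_commute)
  show thesis
  proof
    show "mspace (metric (h ` mspace X, ?d)) = h ` mspace X"
      by (rule Metric_space.mspace_metric[OF M])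
    show "mdist (metric (h ` mspace X, ?d)) (h x) (h x') = mdist X x x'"
      if "x \<in> mspace X" "x' \<in> mspace X" for x x'
      using that h by (simp add: Metric_space.mdist_metric[OF M] inv_into_f_f)
  qed
qed

lemma compact_metric_bounded:
  assumes "compact_metric X"
  obtains D where "0 \<le> D" "\<And>x x'. x \<in> mspace X \<Longrightarrow> x' \<in> mspace X \<Longrightarrow> mdist X x x' \<le> D"
proof -
  interpret Metric_space "mspace X" "mdist X"
    by simp
  have "compactin mtopology (mspace X)"
    using assms unfolding compact_metric_def compact_space_def mtopology_of_def by simp
  then have "mbounded (mspace X)"
    using compactin_imp_mbounded by blast
  then obtain B where "\<And>x x'. x \<in> mspace X \<Longrightarrow> x' \<in> mspace X \<Longrightarrow> mdist X x x' \<le> B"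
    unfolding mbounded_alt by blast
  then show thesis
    using that[of "max 0 B"] by (simp add: max.coboundedI2)
qed

lemma compact_metric_lepoll_real:
  fixes X :: "'a metric"
  assumes "compact_metric X"
  shows "mspace X \<lesssim> (UNIV :: real set)"
proof -
  interpret Metric_space "mspace X" "mdist X"
    by simp
  have "mtotally_bounded (mspace X)"
    using assms unfolding compact_metric_def compact_space_def mtopology_of_def
    by (simp add: compactin_imp_mtotally_bounded)
  then have "\<exists>K. finite K \<and> K \<subseteq> mspace X \<and> mspace X \<subseteq> (\<Union>x\<in>K. mball x (inverse (real (Suc n))))" for n
    unfolding mtotally_bounded_def by simp
  then obtain K where K: "\<And>n. finite (K n)" "\<And>n. K n \<subseteq> mspace X"
      "\<And>n. mspace X \<subseteq> (\<Union>x\<in>K n. mball x (inverse (real (Suc n))))"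
    by metis
  define C where "C = (\<Union>n. K n) \<times> (UNIV :: nat set)"
  have "countable C"
    unfolding C_def using K(1) by (intro countable_SIGMA countable_UN) (auto simp: countable_finite)
  define F where "F x = {(c, n) \<in> C. mdist X x c < inverse (real (Suc n))}" for x
  have "inj_on F (mspace X)"
  proof (rule inj_onI, rule ccontr)
    fix x y
    assume xy: "x \<in> mspace X" "y \<in> mspace X" "F x = F y" "x \<noteq> y"
    then have "0 < mdist X x y / 2"
      by (simp add: less_le)
    then obtain n where n: "inverse (real (Suc n)) < mdist X x y / 2"
      using reals_Archimedean by blast
    obtain c where c: "c \<in> K n" "mdist X c x < inverse (real (Suc n))"
      using K(3)[of n] xy(1) by (auto simp: in_mball)
    then have "(c, n) \<in> F x"
      unfolding F_def C_def by (auto simp: mdist_commute)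
    then have "mdist X y c < inverse (real (Suc n))"
      using xy(3) unfolding F_def by auto
    moreover have "mdist X x y \<le> mdist X x c + mdist X c y"
      using c K(2) xy by (intro mdist_triangle) auto
    ultimately show False
      using n c by (simp add: mdist_commute)
  qed
  moreover have "F ` mspace X \<subseteq> Pow C"
    unfolding F_def by auto
  moreover have "inj_on (image (to_nat_on C)) (Pow C)"
    using inj_on_to_nat_on[OF \<open>countable C\<close>] by (simp add: inj_on_image_Pow)
  ultimately have "inj_on (image (to_nat_on C) \<circ> F) (mspace X)"
    by (meson comp_inj_on inj_on_subset)
  then have "mspace X \<lesssim> (UNIV :: nat set set)"
    unfolding lepoll_def by blast
  then show ?thesis
    using nat_sets_eqpoll_reals lepoll_trans2 by blast
qed

lemma ex_isometric_real_metric: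
  fixes X :: "'a metric"
  assumes "compact_metric X"
  shows "\<exists>Y :: real metric. compact_metric Y \<and> isometric X Y"
proof -
  obtain h :: "'a \<Rightarrow> real" where h: "inj_on h (mspace X)"
    using compact_metric_lepoll_real[OF assms] unfolding lepoll_def by blast
  obtain Y :: "real metric" where "mspace Y = h ` mspace X"
      "\<And>x x'. x \<in> mspace X \<Longrightarrow> x' \<in> mspace X \<Longrightarrow> mdist Y (h x) (h x') = mdist X x x'"
    using metric_transport[OF h] by blast
  then have "isometric X Y"
    unfolding isometric_def by auto
  then show ?thesis
    using assms compact_metric_isometric by blast
qed


subsection \<open>Correspondences\<close>

text \<open>
  The bound \<open>e\<close> is on the distortion; the Gromov-Hausdorff distance is half the infimum of
  the distortions of correspondences.
\<close>

definition correspondence :: "'a metric \<Rightarrow> 'b metric \<Rightarrow> real \<Rightarrow> ('a \<times> 'b) set \<Rightarrow> bool" where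
  "correspondence X Y e R \<longleftrightarrow>
     R \<subseteq> mspace X \<times> mspace Y \<and> fst ` R = mspace X \<and> snd ` R = mspace Y \<and>
     (\<forall>(x, y)\<in>R. \<forall>(x', y')\<in>R. \<bar>mdist X x x' - mdist Y y y'\<bar> \<le> e)"

lemma correspondenceI:
  assumes "R \<subseteq> mspace X \<times> mspace Y"
    and "\<And>x. x \<in> mspace X \<Longrightarrow> \<exists>y. (x, y) \<in> R" and "\<And>y. y \<in> mspace Y \<Longrightarrow> \<exists>x. (x, y) \<in> R"
    and "\<And>x y x' y'. (x, y) \<in> R \<Longrightarrow> (x', y') \<in> R \<Longrightarrow> \<bar>mdist X x x' - mdist Y y y'\<bar> \<le> e"
  shows "correspondence X Y e R"
proof -
  have "fst ` R = mspace X" "snd ` R = mspace Y"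
    using assms(1-3) by force+
  moreover have "\<forall>(x, y)\<in>R. \<forall>(x', y')\<in>R. \<bar>mdist X x x' - mdist Y y y'\<bar> \<le> e"
    using assms(4) by blast
  ultimately show ?thesis
    using assms(1) unfolding correspondence_def by blast
qed

lemma correspondenceD:
  assumes "correspondence X Y e R"
  shows "\<And>x y. (x, y) \<in> R \<Longrightarrow> x \<in> mspace X \<and> y \<in> mspace Y"
    and "\<And>x. x \<in> mspace X \<Longrightarrow> \<exists>y. (x, y) \<in> R" and "\<And>y. y \<in> mspace Y \<Longrightarrow> \<exists>x. (x, y) \<in> R"
    and "\<And>x y x' y'. (x, y) \<in> R \<Longrightarrow> (x', y') \<in> R \<Longrightarrow> \<bar>mdist X x x' - mdist Y y y'\<bar> \<le> e"
proof -
  have R: "R \<subseteq> mspace X \<times> mspace Y" "fst ` R = mspace X" "snd ` R = mspace Y"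
    "\<forall>(x, y)\<in>R. \<forall>(x', y')\<in>R. \<bar>mdist X x x' - mdist Y y y'\<bar> \<le> e"
    using assms unfolding correspondence_def by auto
  show "x \<in> mspace X \<and> y \<in> mspace Y" if "(x, y) \<in> R" for x y
    using that R(1) by auto
  show "\<exists>y. (x, y) \<in> R" if "x \<in> mspace X" for x
    using that R(2) by force
  show "\<exists>x. (x, y) \<in> R" if "y \<in> mspace Y" for y
    using that R(3) by force
  show "\<bar>mdist X x x' - mdist Y y y'\<bar> \<le> e" if "(x, y) \<in> R" "(x', y') \<in> R" for x y x' y'
    using that R(4) by blast
qed

lemma correspondence_converse:
  assumes "correspondence X Y e R"
  shows "correspondence Y X e (R\<inverse>)"
proof (rule correspondenceI)
  show "\<bar>mdist Y x x' - mdist X y y'\<bar> \<le> e" if "(x, y) \<in> R\<inverse>" "(x', y') \<in> R\<inverse>" for x y x' y'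
    using correspondenceD(4)[OF assms, of y x y' x'] that by (simp add: abs_minus_commute)
qed (use correspondenceD[OF assms] in auto)

lemma correspondence_relcomp:
  assumes R: "correspondence X Y e R" and S: "correspondence Y Z e' S"
  shows "correspondence X Z (e + e') (R O S)"
proof (rule correspondenceI)
  show "R O S \<subseteq> mspace X \<times> mspace Z"
    using correspondenceD(1)[OF R] correspondenceD(1)[OF S] by blast
  show "\<exists>z. (x, z) \<in> R O S" if "x \<in> mspace X" for x
    using correspondenceD(1,2)[OF R] correspondenceD(2)[OF S] that by blast
  show "\<exists>x. (x, z) \<in> R O S" if "z \<in> mspace Z" for z
    using correspondenceD(3)[OF R] correspondenceD(1,3)[OF S] that by blast
  show "\<bar>mdist X x x' - mdist Z z z'\<bar> \<le> e + e'" if "(x, z) \<in> R O S" "(x', z') \<in> R O S" for x z x' z'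
  proof -
    obtain y y' where "(x, y) \<in> R" "(y, z) \<in> S" "(x', y') \<in> R" "(y', z') \<in> S"
      using \<open>(x, z) \<in> R O S\<close> \<open>(x', z') \<in> R O S\<close> by blast
    then have "\<bar>mdist X x x' - mdist Y y y'\<bar> \<le> e" "\<bar>mdist Y y y' - mdist Z z z'\<bar> \<le> e'"
      using correspondenceD(4)[OF R] correspondenceD(4)[OF S] by auto
    then show ?thesis
      by linarith
  qed
qed

lemma hausdorff_dist_lessD:
  assumes "compact_metric X" "compact_metric Y"
    and f: "isometric_injection X Z f" and g: "isometric_injection Y Z g"
    and less: "hausdorff_dist Z (f ` mspace X) (g ` mspace Y) < r"
  obtains R where "correspondence X Y (2 * r) R"
proof -
  let ?S = "{r. 0 < r \<and> (\<forall>a\<in>f ` mspace X. \<exists>b\<in>g ` mspace Y. mdist Z a b < r) \<and>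
                (\<forall>b\<in>g ` mspace Y. \<exists>a\<in>f ` mspace X. mdist Z a b < r)}"
  have fZ: "f x \<in> mspace Z" if "x \<in> mspace X" for x
    using f that unfolding isometric_injection_def by auto
  have gZ: "g y \<in> mspace Z" if "y \<in> mspace Y" for y
    using g that unfolding isometric_injection_def by auto
  have fd: "mdist Z (f x) (f x') = mdist X x x'" if "x \<in> mspace X" "x' \<in> mspace X" for x x'
    using f that unfolding isometric_injection_def by auto
  have gd: "mdist Z (g x) (g x') = mdist Y x x'" if "x \<in> mspace Y" "x' \<in> mspace Y" for x x'
    using g that unfolding isometric_injection_def by auto
  obtain D where D: "0 \<le> D" "\<And>x x'. x \<in> mspace X \<Longrightarrow> x' \<in> mspace X \<Longrightarrow> mdist X x x' \<le> D"
    using compact_metric_bounded assms(1) by blast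
  obtain E where E: "0 \<le> E" "\<And>x x'. x \<in> mspace Y \<Longrightarrow> x' \<in> mspace Y \<Longrightarrow> mdist Y x x' \<le> E"
    using compact_metric_bounded assms(2) by blast
  obtain x0 y0 where 0: "x0 \<in> mspace X" "y0 \<in> mspace Y"
    using assms(1,2) unfolding compact_metric_def by blast
  define q where "q = mdist Z (f x0) (g y0) + D + E + 1"
  have "mdist Z (f x) (g y) < q" if "x \<in> mspace X" "y \<in> mspace Y" for x y
  proof -
    have "mdist Z (f x) (g y) \<le> mdist Z (f x) (f x0) + mdist Z (f x0) (g y)"
      using that 0 fZ gZ by (intro mdist_triangle) auto
    moreover have "mdist Z (f x0) (g y) \<le> mdist Z (f x0) (g y0) + mdist Z (g y0) (g y)"
      using that 0 fZ gZ by (intro mdist_triangle) auto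
    ultimately show ?thesis
      using D(2)[OF that(1) 0(1)] E(2)[OF 0(2) that(2)] that 0
      unfolding q_def by (simp add: fd gd)
  qed
  moreover have "0 < q"
    unfolding q_def using D(1) E(1) mdist_nonneg[of Z "f x0" "g y0"] by linarith
  ultimately have "q \<in> ?S"
    using 0 by blast
  then have "?S \<noteq> {}"
    by blast
  from cInf_lessD[OF this less[unfolded hausdorff_dist_def]]
  obtain t where t: "t \<in> ?S" "t < r"
    by blast
  define R where "R = {(x, y). x \<in> mspace X \<and> y \<in> mspace Y \<and> mdist Z (f x) (g y) < t}"
  have "correspondence X Y (2 * r) R"
  proof (rule correspondenceI)
    show "R \<subseteq> mspace X \<times> mspace Y"
      unfolding R_def by auto
    show "\<exists>y. (x, y) \<in> R" if "x \<in> mspace X" for x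
      using t that unfolding R_def by auto
    show "\<exists>x. (x, y) \<in> R" if "y \<in> mspace Y" for y
      using t that unfolding R_def by auto
    show "\<bar>mdist X x x' - mdist Y y y'\<bar> \<le> 2 * r" if "(x, y) \<in> R" "(x', y') \<in> R" for x y x' y'
    proof -
      have m: "x \<in> mspace X" "x' \<in> mspace X" "y \<in> mspace Y" "y' \<in> mspace Y"
        and l: "mdist Z (f x) (g y) < t" "mdist Z (f x') (g y') < t"
        using that unfolding R_def by auto
      have "mdist Z (f x) (f x') \<le> mdist Z (f x) (g y) + mdist Z (g y) (f x')"
        "mdist Z (g y) (f x') \<le> mdist Z (g y) (g y') + mdist Z (g y') (f x')"
        "mdist Z (g y) (g y') \<le> mdist Z (g y) (f x) + mdist Z (f x) (g y')"
        "mdist Z (f x) (g y') \<le> mdist Z (f x) (f x') + mdist Z (f x') (g y')"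
        using m fZ gZ by (auto intro: mdist_triangle)
      then show ?thesis
        using l t(2) fd[OF m(1,2)] gd[OF m(3,4)]
          mdist_commute[of Z "g y" "f x"] mdist_commute[of Z "g y'" "f x'"]
        by linarith
    qed
  qed
  then show thesis
    by (rule that)
qed

lemma correspondence_imp_ambient:
  fixes X Y :: "real metric"
  assumes "compact_metric X" "compact_metric Y" "0 < s" "correspondence X Y (2 * s) R"
  obtains Z :: "real metric" and f g
  where "isometric_injection X Z f" "isometric_injection Y Z g"
    "hausdorff_dist Z (f ` mspace X) (g ` mspace Y) \<le> s"
proof -
  note R = correspondenceD[OF assms(4)]
  have ne: "R \<noteq> {}"
    using assms(1) R(2) unfolding compact_metric_def by blast
  define c where "c x y = (INF (x', y')\<in>R. mdist X x x' + s + mdist Y y' y)" for x y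
  have bdd: "bdd_below ((\<lambda>(x', y'). mdist X x x' + s + mdist Y y' y) ` R)" for x y
    using assms(3) by (intro bdd_belowI2[of _ s]) (auto simp: add_increasing)
  have c_le: "c x y \<le> mdist X x x' + s + mdist Y y' y" if "(x', y') \<in> R" for x y x' y'
    unfolding c_def using cINF_lower[OF bdd that] by simp
  have c_ge: "s \<le> c x y" for x y
    unfolding c_def using ne by (intro cINF_greatest) (auto simp: add_increasing add_increasing2)
  have c_less: "\<exists>x' y'. (x', y') \<in> R \<and> mdist X x x' + s + mdist Y y' y < r" if "c x y < r" for x y r
    using that cInf_lessD[of "(\<lambda>(x', y'). mdist X x x' + s + mdist Y y' y) ` R" r] ne
    unfolding c_def by fastforce
  define M where "M = Inl ` mspace X \<union> Inr ` mspace Y"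
  define d where "d u v = (case (u, v) of (Inl x, Inl x') \<Rightarrow> mdist X x x' | (Inl x, Inr y) \<Rightarrow> c x y
      | (Inr y, Inl x) \<Rightarrow> c x y | (Inr y, Inr y') \<Rightarrow> mdist Y y y')" for u v
  have d_simps: "d (Inl x) (Inl x') = mdist X x x'" "d (Inl x) (Inr y) = c x y"
    "d (Inr y) (Inl x) = c x y" "d (Inr y) (Inr y') = mdist Y y y'" for x x' y y'
    unfolding d_def by auto
  have tri1: "c x y \<le> mdist X x x' + c x' y" if "x \<in> mspace X" "x' \<in> mspace X" for x x' y
  proof (rule dense_ge)
    fix r assume "mdist X x x' + c x' y < r"
    then have "c x' y < r - mdist X x x'"
      by simp
    then obtain p q where pq: "(p, q) \<in> R" "mdist X x' p + s + mdist Y q y < r - mdist X x x'"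
      using c_less by blast
    then have "mdist X x p \<le> mdist X x x' + mdist X x' p"
      using R(1) that by (intro mdist_triangle) auto
    then show "c x y \<le> r"
      using c_le[OF pq(1), of x y] pq(2) by linarith
  qed
  have tri2: "c x y \<le> c x y' + mdist Y y' y" if "y \<in> mspace Y" "y' \<in> mspace Y" for x y y'
  proof (rule dense_ge)
    fix r assume "c x y' + mdist Y y' y < r"
    then have "c x y' < r - mdist Y y' y"
      by simp
    then obtain p q where pq: "(p, q) \<in> R" "mdist X x p + s + mdist Y q y' < r - mdist Y y' y"
      using c_less by blast
    then have "mdist Y q y \<le> mdist Y q y' + mdist Y y' y"
      using R(1) that by (intro mdist_triangle) auto
    then show "c x y \<le> r"
      using c_le[OF pq(1), of x y] pq(2) by linarith
  qed
  have tri3: "mdist X x x' \<le> c x y + c x' y"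
    if "x \<in> mspace X" "x' \<in> mspace X" "y \<in> mspace Y" for x x' y
  proof (rule dense_ge)
    fix r assume r: "c x y + c x' y < r"
    then have "c x y < r - c x' y"
      by simp
    then obtain p q where pq: "(p, q) \<in> R" "mdist X x p + s + mdist Y q y < r - c x' y"
      using c_less by blast
    then have "c x' y < r - (mdist X x p + s + mdist Y q y)"
      by simp
    then obtain p' q' where pq': "(p', q') \<in> R"
        "mdist X x' p' + s + mdist Y q' y < r - (mdist X x p + s + mdist Y q y)"
      using c_less by blast
    have "mdist X x x' \<le> mdist X x p + mdist X p x'" "mdist X p x' \<le> mdist X p p' + mdist X p' x'"
      "mdist Y q q' \<le> mdist Y q y + mdist Y y q'"
      using R(1)[OF pq(1)] R(1)[OF pq'(1)] that by (auto intro: mdist_triangle)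
    moreover have "\<bar>mdist X p p' - mdist Y q q'\<bar> \<le> 2 * s"
      using R(4)[OF pq(1) pq'(1)] .
    ultimately show "mdist X x x' \<le> r"
      using pq(2) pq'(2) mdist_commute[of X p' x'] mdist_commute[of Y y q'] by linarith
  qed
  have tri4: "mdist Y y y' \<le> c x y + c x y'"
    if "y \<in> mspace Y" "y' \<in> mspace Y" "x \<in> mspace X" for x y y'
  proof (rule dense_ge)
    fix r assume r: "c x y + c x y' < r"
    then have "c x y < r - c x y'"
      by simp
    then obtain p q where pq: "(p, q) \<in> R" "mdist X x p + s + mdist Y q y < r - c x y'"
      using c_less by blast
    then have "c x y' < r - (mdist X x p + s + mdist Y q y)"
      by simp
    then obtain p' q' where pq': "(p', q') \<in> R"
        "mdist X x p' + s + mdist Y q' y' < r - (mdist X x p + s + mdist Y q y)"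
      using c_less by blast
    have "mdist Y y y' \<le> mdist Y y q + mdist Y q y'" "mdist Y q y' \<le> mdist Y q q' + mdist Y q' y'"
      "mdist X p p' \<le> mdist X p x + mdist X x p'"
      using R(1)[OF pq(1)] R(1)[OF pq'(1)] that by (auto intro: mdist_triangle)
    moreover have "\<bar>mdist X p p' - mdist Y q q'\<bar> \<le> 2 * s"
      using R(4)[OF pq(1) pq'(1)] .
    ultimately show "mdist Y y y' \<le> r"
      using pq(2) pq'(2) mdist_commute[of X p x] mdist_commute[of Y y q] by linarith
  qed
  have M: "Metric_space M d"
  proof
    show "0 \<le> d u v" for u v
    proof -
      have "0 \<le> c x y" for x y
        using c_ge[of x y] assms(3) by linarith
      then show ?thesis
        unfolding d_def by (auto split: sum.split)
    qed
    show "d u v = d v u" for u v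
      unfolding d_def by (auto split: sum.split simp: mdist_commute)
    show "d u v = 0 \<longleftrightarrow> u = v" if "u \<in> M" "v \<in> M" for u v
    proof -
      have "c x y \<noteq> 0" for x y
        using c_ge[of x y] assms(3) by linarith
      then show ?thesis
        using that unfolding M_def by (elim UnE imageE) (simp_all add: d_simps)
    qed
    have tri1': "c x y \<le> c x' y + mdist X x' x" if "x \<in> mspace X" "x' \<in> mspace X" for x x' y
      using tri1[OF that, of y] by (simp add: mdist_commute[of X x'])
    have tri2': "c x y \<le> mdist Y y y' + c x y'" if "y \<in> mspace Y" "y' \<in> mspace Y" for x y y'
      using tri2[OF that, of x] by (simp add: mdist_commute[of Y y])
    show "d u w \<le> d u v + d v w" if "u \<in> M" "v \<in> M" "w \<in> M" for u v w
      using that unfolding M_def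
      by (elim UnE imageE)
        (simp_all only: d_simps mdist_triangle tri1 tri1' tri2 tri2' tri3 tri4)
  qed
  interpret U: Metric_space M d
    by (rule M)
  obtain h :: "real + real \<Rightarrow> real" where h: "inj h"
  proof -
    obtain e :: "real \<Rightarrow> real" where e: "inj e" "range e \<subseteq> {0..<1}"
      using reals_lepoll_reals01 unfolding lepoll_def by blast
    have e01: "0 \<le> e x" "e x < 1" for x
      using e(2) by (auto simp: image_subset_iff)
    have e01': "e x \<noteq> e y + 1" "e y + 1 \<noteq> e x" for x y
      using e01(2)[of x] e01(1)[of y] by linarith+
    have "inj (case_sum e (\<lambda>x. e x + 1))"
    proof (rule injI)
      fix u v assume "case_sum e (\<lambda>x. e x + 1) u = case_sum e (\<lambda>x. e x + 1) v"
      then show "u = v"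
        using injD[OF e(1)] e01' by (cases u; cases v) auto
    qed
    then show thesis
      by (rule that)
  qed
  obtain Z :: "real metric" where Z: "mspace Z = h ` M"
      "\<And>u v. u \<in> M \<Longrightarrow> v \<in> M \<Longrightarrow> mdist Z (h u) (h v) = d u v"
    using metric_transport[of h U.Self] h inj_on_subset[OF h, of M] by auto
  have iX: "isometric_injection X Z (h \<circ> Inl)" and iY: "isometric_injection Y Z (h \<circ> Inr)"
    unfolding isometric_injection_def using Z by (auto simp: M_def d_simps)
  have "hausdorff_dist Z ((h \<circ> Inl) ` mspace X) ((h \<circ> Inr) ` mspace Y) \<le> s"
  proof (rule dense_ge)
    fix r assume "s < r"
    have *: "mdist Z (h (Inl x)) (h (Inr y)) < r" if "(x, y) \<in> R" for x y
    proof -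
      have "x \<in> mspace X" "y \<in> mspace Y"
        using R(1)[OF that] by auto
      then have 0: "mdist X x x = 0" "mdist Y y y = 0"
        by simp_all
      have "c x y \<le> s"
        using c_le[OF that, of x y] by (simp only: 0 add_0 add_0_right)
      moreover have "mdist Z (h (Inl x)) (h (Inr y)) = c x y"
        using \<open>x \<in> mspace X\<close> \<open>y \<in> mspace Y\<close> Z(2)[of "Inl x" "Inr y"] by (simp add: M_def d_simps)
      ultimately show ?thesis
        using \<open>s < r\<close> by simp
    qed
    have "r \<in> {r. 0 < r \<and> (\<forall>a\<in>(h \<circ> Inl) ` mspace X. \<exists>b\<in>(h \<circ> Inr) ` mspace Y. mdist Z a b < r) \<and>
          (\<forall>b\<in>(h \<circ> Inr) ` mspace Y. \<exists>a\<in>(h \<circ> Inl) ` mspace X. mdist Z a b < r)}"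
    proof (simp, intro conjI ballI)
      show "0 < r"
        using assms(3) \<open>s < r\<close> by linarith
      show "\<exists>y\<in>mspace Y. mdist Z (h (Inl x)) (h (Inr y)) < r" if "x \<in> mspace X" for x
        using R(2)[OF that] R(1) * by blast
      show "\<exists>x\<in>mspace X. mdist Z (h (Inl x)) (h (Inr y)) < r" if "y \<in> mspace Y" for y
        using R(3)[OF that] R(1) * by blast
    qed
    then show "hausdorff_dist Z ((h \<circ> Inl) ` mspace X) ((h \<circ> Inr) ` mspace Y) \<le> r"
      unfolding hausdorff_dist_def by (rule cInf_lower) (auto intro: bdd_belowI[of _ 0])
  qed
  with iX iY show thesis
    by (rule that)
qed

lemma hausdorff_dist_nonneg:
  assumes "compact_metric X" "compact_metric Y"
    and "isometric_injection X Z f" "isometric_injection Y Z g"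
  shows "0 \<le> hausdorff_dist Z (f ` mspace X) (g ` mspace Y)"
proof (rule ccontr)
  assume "\<not> ?thesis"
  then obtain r where r: "hausdorff_dist Z (f ` mspace X) (g ` mspace Y) < r" "r < 0"
    using dense[of "hausdorff_dist Z (f ` mspace X) (g ` mspace Y)" 0] by auto
  obtain R where "correspondence X Y (2 * r) R"
    using hausdorff_dist_lessD[OF assms r(1)] by blast
  note R = correspondenceD[OF this]
  obtain x y where "(x, y) \<in> R"
    using R(2) assms(1) unfolding compact_metric_def by blast
  then show False
    using R(4)[of x y x y] r(2) by linarith
qed

lemma correspondence_Times:
  assumes "compact_metric X" "compact_metric Y"
  obtains s where "0 < s" "correspondence X Y (2 * s) (mspace X \<times> mspace Y)"
proof -
  obtain D where D: "0 \<le> D" "\<And>x x'. x \<in> mspace X \<Longrightarrow> x' \<in> mspace X \<Longrightarrow> mdist X x x' \<le> D"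
    using compact_metric_bounded assms(1) by blast
  obtain E where E: "0 \<le> E" "\<And>x x'. x \<in> mspace Y \<Longrightarrow> x' \<in> mspace Y \<Longrightarrow> mdist Y x x' \<le> E"
    using compact_metric_bounded assms(2) by blast
  have "correspondence X Y (2 * (D + E + 1)) (mspace X \<times> mspace Y)"
  proof (rule correspondenceI)
    show "\<bar>mdist X x x' - mdist Y y y'\<bar> \<le> 2 * (D + E + 1)"
      if "(x, y) \<in> mspace X \<times> mspace Y" "(x', y') \<in> mspace X \<times> mspace Y" for x y x' y'
    proof -
      have *: "\<bar>a - b\<bar> \<le> 2 * (D + E + 1)" if "0 \<le> a" "a \<le> D" "0 \<le> b" "b \<le> E" for a b
        by (rule abs_leI) (use that D(1) E(1) in \<open>simp_all add: algebra_simps\<close>)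
      show ?thesis
        by (rule *) (use that D(2) E(2) in auto)
    qed
  qed (use assms in \<open>auto simp: compact_metric_def\<close>)
  then show thesis
    using that[of "D + E + 1"] D(1) E(1) by linarith
qed

lemma GH_distance_nonneg:
  assumes "compact_metric X" "compact_metric Y"
  shows "0 \<le> GH_distance X Y"
proof -
  obtain s where "0 < s" "correspondence X Y (2 * s) (mspace X \<times> mspace Y)"
    using correspondence_Times[OF assms] by blast
  then obtain Z :: "real metric" and f g
    where "isometric_injection X Z f" "isometric_injection Y Z g"
    using correspondence_imp_ambient[OF assms] by blast
  then have ne: "{hausdorff_dist Z (f ` mspace X) (g ` mspace Y) | (Z :: real metric) f g.
            isometric_injection X Z f \<and> isometric_injection Y Z g} \<noteq> {}"
    by blast
  show ?thesis
    unfolding GH_distance_def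
    by (rule cInf_greatest[OF ne]) (elim CollectE exE conjE, simp add: hausdorff_dist_nonneg[OF assms])
qed

lemma GH_distance_le_correspondence:
  assumes "compact_metric X" "compact_metric Y" "0 < s" "correspondence X Y (2 * s) R"
  shows "GH_distance X Y \<le> s"
proof -
  obtain Z :: "real metric" and f g where Z: "isometric_injection X Z f" "isometric_injection Y Z g"
      "hausdorff_dist Z (f ` mspace X) (g ` mspace Y) \<le> s"
    using correspondence_imp_ambient[OF assms] by blast
  have "GH_distance X Y \<le> hausdorff_dist Z (f ` mspace X) (g ` mspace Y)"
    unfolding GH_distance_def
  proof (rule cInf_lower)
    show "bdd_below {hausdorff_dist Z (f ` mspace X) (g ` mspace Y) | (Z :: real metric) f g.
            isometric_injection X Z f \<and> isometric_injection Y Z g}"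
      by (rule bdd_belowI[of _ 0]) (elim CollectE exE conjE, simp add: hausdorff_dist_nonneg[OF assms(1,2)])
  qed (use Z in blast)
  with Z(3) show ?thesis
    by linarith
qed

lemma GH_distance_lessD:
  assumes "compact_metric X" "compact_metric Y" "GH_distance X Y < r"
  obtains R where "correspondence X Y (2 * r) R"
proof -
  obtain s where "0 < s" "correspondence X Y (2 * s) (mspace X \<times> mspace Y)"
    using correspondence_Times[OF assms(1,2)] by blast
  then obtain Z :: "real metric" and f g
    where "isometric_injection X Z f" "isometric_injection Y Z g"
    using correspondence_imp_ambient[OF assms(1,2)] by blast
  then have ne: "{hausdorff_dist Z (f ` mspace X) (g ` mspace Y) | (Z :: real metric) f g.
            isometric_injection X Z f \<and> isometric_injection Y Z g} \<noteq> {}"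
    by blast
  obtain Z :: "real metric" and f g
    where "isometric_injection X Z f" "isometric_injection Y Z g"
      "hausdorff_dist Z (f ` mspace X) (g ` mspace Y) < r"
    using cInf_lessD[OF ne assms(3)[unfolded GH_distance_def]] by blast
  then show thesis
    using hausdorff_dist_lessD[OF assms(1,2)] that by blast
qed

lemma GH_distance_le:
  fixes Z :: "'c metric"
  assumes "compact_metric X" "compact_metric Y"
    and "isometric_injection X Z f" "isometric_injection Y Z g"
  shows "GH_distance X Y \<le> hausdorff_dist Z (f ` mspace X) (g ` mspace Y)"
proof (rule dense_ge)
  fix r assume r: "hausdorff_dist Z (f ` mspace X) (g ` mspace Y) < r"
  then obtain R where "correspondence X Y (2 * r) R"
    by (rule hausdorff_dist_lessD[OF assms])
  moreover have "0 < r"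
    using r hausdorff_dist_nonneg[OF assms] by linarith
  ultimately show "GH_distance X Y \<le> r"
    by (rule GH_distance_le_correspondence[OF assms(1,2), rotated])
qed

lemma GH_distance_sym_le:
  assumes "compact_metric X" "compact_metric Y"
  shows "GH_distance Y X \<le> GH_distance X Y"
proof (rule dense_ge)
  fix r assume r: "GH_distance X Y < r"
  then have "0 < r"
    using GH_distance_nonneg[OF assms] by linarith
  obtain R where "correspondence X Y (2 * r) R"
    using GH_distance_lessD[OF assms r] by blast
  then show "GH_distance Y X \<le> r"
    by (rule GH_distance_le_correspondence[OF assms(2,1) \<open>0 < r\<close> correspondence_converse])
qed

lemma GH_distance_commute:
  assumes "compact_metric X" "compact_metric Y"
  shows "GH_distance X Y = GH_distance Y X"
  using GH_distance_sym_le assms by (simp add: antisym)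

lemma GH_distance_triangle:
  assumes "compact_metric X" "compact_metric Y" "compact_metric Z"
  shows "GH_distance X Z \<le> GH_distance X Y + GH_distance Y Z"
proof (rule field_le_epsilon)
  fix e :: real assume "0 < e"
  have pos: "0 \<le> GH_distance X Y" "0 \<le> GH_distance Y Z"
    using GH_distance_nonneg assms by auto
  obtain R where R: "correspondence X Y (2 * (GH_distance X Y + e / 2)) R"
    using GH_distance_lessD[OF assms(1,2), of "GH_distance X Y + e / 2"] \<open>0 < e\<close> by auto
  obtain S where S: "correspondence Y Z (2 * (GH_distance Y Z + e / 2)) S"
    using GH_distance_lessD[OF assms(2,3), of "GH_distance Y Z + e / 2"] \<open>0 < e\<close> by auto
  have "correspondence X Z (2 * (GH_distance X Y + GH_distance Y Z + e)) (R O S)"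
    using correspondence_relcomp[OF R S] by (simp add: algebra_simps)
  then show "GH_distance X Z \<le> GH_distance X Y + GH_distance Y Z + e"
    using GH_distance_le_correspondence[OF assms(1,3)] pos \<open>0 < e\<close> by (simp add: add_nonneg_pos)
qed

lemma isometric_imp_GH_distance_0:
  assumes "compact_metric X" "compact_metric Y" "isometric X Y"
  shows "GH_distance X Y = 0"
proof -
  obtain f where f: "f ` mspace X = mspace Y"
      "\<And>x x'. x \<in> mspace X \<Longrightarrow> x' \<in> mspace X \<Longrightarrow> mdist Y (f x) (f x') = mdist X x x'"
    using assms(3) unfolding isometric_def by blast
  have "GH_distance X Y \<le> s" if "0 < s" for s
  proof (rule GH_distance_le_correspondence[OF assms(1,2) that])
    show "correspondence X Y (2 * s) ((\<lambda>x. (x, f x)) ` mspace X)"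
    proof (rule correspondenceI)
      show "\<exists>x. (x, y) \<in> (\<lambda>x. (x, f x)) ` mspace X" if "y \<in> mspace Y" for y
        using that unfolding f(1)[symmetric] by blast
    qed (use f that in auto)
  qed
  then have "GH_distance X Y \<le> 0"
    by (rule dense_ge)
  then show ?thesis
    using GH_distance_nonneg[OF assms(1,2)] by linarith
qed

lemma GH_distance_0_imp_isometric:
  assumes "compact_metric X" "compact_metric Y" "GH_distance X Y = 0"
  shows "isometric X Y"
proof -
  define I where "I = Inl ` mspace X \<union> Inr ` mspace Y"
  define W where "W i = (case i of Inl x \<Rightarrow> mtopology_of Y | Inr y \<Rightarrow> mtopology_of X)"
    for i :: "real + real"
  define P where "P = product_topology W I"
  define C where "C = (\<lambda>(e, x, y). {h \<in> topspace P.
      \<bar>mdist X x (h (Inr y)) - mdist Y (h (Inl x)) y\<bar> \<in> {..e}})"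
  have "compact_space P"
    unfolding P_def W_def I_def compact_space_product_topology
    using assms(1,2) by (auto simp: compact_metric_def)
  have cl: "closedin P (C (e, x, y))" if "x \<in> mspace X" "y \<in> mspace Y" for e x y
  proof -
    have "continuous_map P (W (Inr y)) (\<lambda>h. h (Inr y))" "continuous_map P (W (Inl x)) (\<lambda>h. h (Inl x))"
      unfolding P_def using that by (auto simp: I_def intro!: continuous_map_product_projection)
    then have "continuous_map P (mtopology_of X) (\<lambda>h. h (Inr y))"
      "continuous_map P (mtopology_of Y) (\<lambda>h. h (Inl x))"
      unfolding W_def by auto
    then have "continuous_map P euclidean (\<lambda>h. \<bar>mdist X x (h (Inr y)) - mdist Y (h (Inl x)) y\<bar>)"
      using that by (intro continuous_map_real_abs continuous_map_diff continuous_map_mdist) auto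
    from closedin_continuous_map_preimage[OF this, of "{..e}"] show ?thesis
      unfolding C_def by simp
  qed
  let ?T = "{0<..} \<times> mspace X \<times> mspace Y"
  have fip: "\<Inter>\<F> \<noteq> {}" if "finite \<F>" "\<F> \<subseteq> C ` ?T" for \<F>
  proof -
    from finite_subset_image[OF that]
    obtain T where T: "finite T" "T \<subseteq> ?T" "\<F> = C ` T"
      by (elim exE conjE bexE) (rule that; assumption)
    define e where "e = Min (insert 1 (fst ` T))"
    have fin: "finite (insert 1 (fst ` T))"
      using T(1) by simp
    have "0 < e"
      unfolding e_def Min_gr_iff[OF fin insert_not_empty] using T(2) by auto
    have e_le: "e \<le> e'" if "(e', x, y) \<in> T" for e' x y
      unfolding e_def by (rule Min_le[OF fin]) (use that in force)
    obtain R where "correspondence X Y (2 * (e / 2)) R"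
      using GH_distance_lessD[OF assms(1,2), of "e / 2"] assms(3) \<open>0 < e\<close> by auto
    note R = correspondenceD[OF this]
    obtain f where f: "\<And>x. x \<in> mspace X \<Longrightarrow> (x, f x) \<in> R"
      using R(2) by metis
    obtain g where g: "\<And>y. y \<in> mspace Y \<Longrightarrow> (g y, y) \<in> R"
      using R(3) by metis
    define h where "h = restrict (case_sum f g) I"
    have hP: "h \<in> topspace P"
      unfolding P_def h_def W_def using R(1) f g by (force simp: I_def)
    have "h \<in> C t" if t: "t \<in> T" for t
    proof -
      obtain e' x y where t': "t = (e', x, y)" "x \<in> mspace X" "y \<in> mspace Y"
        using t T(2) by auto
      have "\<bar>mdist X x (g y) - mdist Y (f x) y\<bar> \<le> e"
        using R(4)[OF f[OF t'(2)] g[OF t'(3)]] by simp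
      then show ?thesis
        using hP e_le[of e' x y] t t' unfolding C_def h_def by (simp add: I_def)
    qed
    then show ?thesis
      using T(3) by blast
  qed
  have "\<Inter>(C ` ?T) \<noteq> {}"
  proof (rule \<open>compact_space P\<close>[unfolded compact_space_fip, rule_format], intro conjI strip)
    show "closedin P D" if "D \<in> C ` ?T" for D
      using that cl by auto
    show "\<Inter>\<F> \<noteq> {}" if "finite \<F> \<and> \<F> \<subseteq> C ` ?T" for \<F>
      using that by (elim conjE) (rule fip)
  qed
  then obtain h where h: "\<And>t. t \<in> ?T \<Longrightarrow> h \<in> C t"
    by blast
  obtain x0 y0 where "x0 \<in> mspace X" "y0 \<in> mspace Y"
    using assms(1,2) unfolding compact_metric_def by blast
  then have hP: "h \<in> topspace P"
    using h[of "(1, x0, y0)"] unfolding C_def by auto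
  define f where "f = h \<circ> Inl"
  define g where "g = h \<circ> Inr"
  have fY: "f x \<in> mspace Y" if "x \<in> mspace X" for x
    using hP that unfolding P_def f_def I_def W_def by (force simp: PiE_iff)
  have gX: "g y \<in> mspace X" if "y \<in> mspace Y" for y
    using hP that unfolding P_def g_def I_def W_def by (force simp: PiE_iff)
  have fg: "mdist X x (g y) = mdist Y (f x) y" if "x \<in> mspace X" "y \<in> mspace Y" for x y
  proof -
    have "\<bar>mdist X x (g y) - mdist Y (f x) y\<bar> \<le> 0 + e" if "0 < e" for e
      using h[of "(e, x, y)"] \<open>x \<in> mspace X\<close> \<open>y \<in> mspace Y\<close> that unfolding C_def f_def g_def by auto
    then have "\<bar>mdist X x (g y) - mdist Y (f x) y\<bar> \<le> 0"
      by (rule field_le_epsilon)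
    then show ?thesis
      by simp
  qed
  have gf: "g (f x) = x" if "x \<in> mspace X" for x
    using fg[OF that fY[OF that]] fY[OF that] gX[OF fY[OF that]] that by (metis mdist_zero)
  have fg': "f (g y) = y" if "y \<in> mspace Y" for y
    using fg[OF gX[OF that] that] gX[OF that] fY[OF gX[OF that]] that by (metis mdist_zero)
  have "f ` mspace X = mspace Y"
  proof (intro subset_antisym image_subsetI subsetI)
    show "y \<in> f ` mspace X" if "y \<in> mspace Y" for y
      using gX[OF that] fg'[OF that] by (metis imageI)
  qed (rule fY)
  moreover have "mdist Y (f x) (f x') = mdist X x x'" if "x \<in> mspace X" "x' \<in> mspace X" for x x'
    using fg[OF that(1) fY[OF that(2)]] gf[OF that(2)] by simp
  ultimately show ?thesis
    unfolding isometric_def by blast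
qed

lemma GH_distance_isometric_cong:
  assumes "compact_metric X" "compact_metric X'" "isometric X X'"
    and "compact_metric Y" "compact_metric Y'" "isometric Y Y'"
  shows "GH_distance X Y = GH_distance X' Y'"
proof (rule antisym)
  have 0: "GH_distance X X' = 0" "GH_distance X' X = 0" "GH_distance Y Y' = 0" "GH_distance Y' Y = 0"
    using assms isometric_imp_GH_distance_0 isometric_sym by blast+
  show "GH_distance X Y \<le> GH_distance X' Y'"
    using GH_distance_triangle[of X X' Y] GH_distance_triangle[of X' Y' Y] 0 assms by simp
  show "GH_distance X' Y' \<le> GH_distance X Y"
    using GH_distance_triangle[of X' X Y'] GH_distance_triangle[of X Y Y'] 0 assms by simp
qed


section \<open>The Gromov-Hausdorff space\<close>

quotient_type GH_space =
  "real metric" / partial: "\<lambda>X Y. compact_metric X \<and> compact_metric Y \<and> isometric X Y"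
proof (rule part_equivpI)
  have "Metric_space {0::real} dist"
    by (simp add: Met_TC.subspace)
  moreover have "mspace (metric ({0::real}, dist)) = {0}"
    using calculation by (rule Metric_space.mspace_metric)
  ultimately have "compact_metric (metric ({0::real}, dist))"
    unfolding compact_metric_def by (simp add: compact_space_def finite_imp_compactin)
  then show "\<exists>X :: real metric. compact_metric X \<and> compact_metric X \<and> isometric X X"
    using isometric_refl by blast
qed (auto intro!: sympI transpI intro: isometric_sym isometric_trans)

instantiation GH_space :: metric_space
begin

lift_definition dist_GH_space :: "GH_space \<Rightarrow> GH_space \<Rightarrow> real" is GH_distance
  by (rule GH_distance_isometric_cong) auto

definition uniformity_GH_space :: "(GH_space \<times> GH_space) filter" where
  "uniformity_GH_space = (INF e\<in>{0<..}. principal {(x, y). dist x y < e})"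

definition open_GH_space :: "GH_space set \<Rightarrow> bool" where
  "open_GH_space U \<longleftrightarrow> (\<forall>x\<in>U. eventually (\<lambda>(x', y). x' = x \<longrightarrow> y \<in> U) uniformity)"

instance
proof
  show "dist x y = 0 \<longleftrightarrow> x = y" for x y :: GH_space
    by transfer (use GH_distance_0_imp_isometric isometric_imp_GH_distance_0 in blast)
  show "dist x y \<le> dist x z + dist y z" for x y z :: GH_space
    by transfer (metis GH_distance_triangle GH_distance_commute)
qed (simp_all add: uniformity_GH_space_def open_GH_space_def)

end


section \<open>Generic properties\<close>

definition rare :: "'a::topological_space set \<Rightarrow> bool" where
  "rare S \<longleftrightarrow> interior (closure S) = {}"

definition meager :: "'a::topological_space set \<Rightarrow> bool" where
  "meager S \<longleftrightarrow> (\<exists>\<R>. countable \<R> \<and> (\<forall>R\<in>\<R>. rare R) \<and> S = \<Union>\<R>)"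

definition residual :: "'a::topological_space set \<Rightarrow> bool" where
  "residual S \<longleftrightarrow> meager (- S)"

definition totally_discontinuous :: "'a topology \<Rightarrow> bool" where
  "totally_discontinuous T \<longleftrightarrow> (\<forall>C\<in>connected_components_of T. \<exists>x. C = {x})"

lemma totally_discontinuous_homeomorphic_map:
  assumes "homeomorphic_map S T f" "totally_discontinuous S"
  shows "totally_discontinuous T"
proof -
  have "connected_components_of T = image f ` connected_components_of S"
    using homeomorphic_map_connected_components_of[OF assms(1)] .
  then show ?thesis
    using assms(2) unfolding totally_discontinuous_def by auto
qed

lift_definition GH_totally_discontinuous :: "GH_space \<Rightarrow> bool"
  is "\<lambda>X. totally_discontinuous (mtopology_of X)"
proof -
  have "totally_discontinuous (mtopology_of Y)"
    if "isometric X Y" "totally_discontinuous (mtopology_of X)" for X Y :: "real metric"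
    using that isometric_imp_homeomorphic_map totally_discontinuous_homeomorphic_map
    unfolding isometric_def by metis
  then show "totally_discontinuous (mtopology_of X) = totally_discontinuous (mtopology_of Y)"
    if "compact_metric X \<and> compact_metric Y \<and> isometric X Y" for X Y :: "real metric"
    using that isometric_sym by blast
qed

end

theory Submission
  imports Defs
begin

text \<open>
  Call a metric space \<open>e\<close>-splittable if it can be partitioned into parts of diameter at most some
  \<open>e' < e\<close> that have pairwise distance at least some \<open>d > 0\<close>. Both bounds have slack, so
  such a partition can be pulled back along a correspondence of small distortion; hence being
  \<open>e\<close>-splittable is an open condition on the Gromov-Hausdorff space. It is a dense
  condition because finite spaces satisfy it and approximate every compact space by finite
  nets. The parts of the partition are open, so a connected set lies in one part; a space that is
  \<open>1/n\<close>-splittable for every \<open>n\<close> is therefore totally discontinuous.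
\<close>

text \<open>The partition is encoded as the fibres of a colouring \<open>k\<close> of the points.\<close>

definition splittable :: "real \<Rightarrow> real metric \<Rightarrow> bool" where
  "splittable e X \<longleftrightarrow>
     (\<exists>d > 0. \<exists>e' < e. \<exists>k :: real \<Rightarrow> real. \<forall>x\<in>mspace X. \<forall>y\<in>mspace X.
        (if k x = k y then mdist X x y \<le> e' else d \<le> mdist X x y))"

lemma splittableI:
  fixes k :: "real \<Rightarrow> real"
  assumes "0 < d" "e' < e"
    and "\<And>x y. x \<in> mspace X \<Longrightarrow> y \<in> mspace X \<Longrightarrow>
      if k x = k y then mdist X x y \<le> e' else d \<le> mdist X x y"
  shows "splittable e X"
  using assms unfolding splittable_def by blast

text \<open>A correspondence gives each point of \<open>Y\<close> a partner in \<open>X\<close>, and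
  \<open>Y\<close> inherits the partner's colour. Distances change by at most the distortion, which
  the slack in both bounds absorbs. \<open>Y\<close> may also be an isometric copy of
  \<open>X\<close>, which later makes the property well defined on isometry classes.\<close>

lemma splittable_near:
  assumes X: "compact_metric X" and "splittable e X"
  obtains r where "0 < r"
    "\<And>Y. compact_metric Y \<Longrightarrow> GH_distance X Y < r \<Longrightarrow> splittable e Y"
proof -
  obtain d e' and k :: "real \<Rightarrow> real" where d: "0 < d" and e': "e' < e"
    and k: "\<And>x y. x \<in> mspace X \<Longrightarrow> y \<in> mspace X \<Longrightarrow>
      if k x = k y then mdist X x y \<le> e' else d \<le> mdist X x y"
    using assms(2) unfolding splittable_def by blast
  \<comment> \<open>The distortion bound is \<open>2 * r\<close>, so this choice uses up at most
    half of each slack, \<open>d\<close> and \<open>e - e'\<close>.\<close>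
  define r where "r = min d (e - e') / 4"
  have r: "0 < r" "2 * r < d" "e' + 2 * r < e"
    using d e' unfolding r_def by (auto simp: min_def field_simps)
  show thesis
  proof
    show "0 < r" by (rule r(1))
    fix Y assume Y: "compact_metric Y" and less: "GH_distance X Y < r"
    obtain R where "correspondence X Y (2 * r) R"
      using GH_distance_lessD[OF X Y less] .
    note R = correspondenceD[OF this]
    obtain g where g: "\<And>y. y \<in> mspace Y \<Longrightarrow> (g y, y) \<in> R"
      using R(3) by metis
    have gX: "g y \<in> mspace X" if "y \<in> mspace Y" for y
      using R(1) g that by blast
    show "splittable e Y"
    proof (rule splittableI)
      show "if (k \<circ> g) y = (k \<circ> g) y' then mdist Y y y' \<le> e' + 2 * r else d - 2 * r \<le> mdist Y y y'"
        if "y \<in> mspace Y" "y' \<in> mspace Y" for y y'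
        using k[OF gX[OF that(1)] gX[OF that(2)]] R(4)[OF g[OF that(1)] g[OF that(2)]]
        by (auto split: if_splits)
    qed (use r in auto)
  qed
qed

text \<open>Every point gets its own colour, so the parts have diameter 0 and the least distance
  between distinct points separates them.\<close>

lemma splittable_finite:
  assumes "finite (mspace X)" "0 < e"
  shows "splittable e X"
proof -
  \<comment> \<open>Inserting 1 keeps \<open>Min D\<close> meaningful when there are no two distinct
    points.\<close>
  define D where "D = insert 1 ((\<lambda>(x, y). mdist X x y) ` {(x, y) \<in> mspace X \<times> mspace X. x \<noteq> y})"
  have fin: "finite D"
    unfolding D_def using assms(1) by (auto intro: finite_subset[of _ "mspace X \<times> mspace X"])
  have pos: "0 < Min D"
    using fin unfolding D_def by (subst Min_gr_iff) (auto simp: less_le)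
  have Min_le: "Min D \<le> mdist X x y" if "x \<in> mspace X" "y \<in> mspace X" "x \<noteq> y" for x y
    using that by (intro Min_le[OF fin]) (auto simp: D_def)
  have "if id x = id y then mdist X x y \<le> 0 else Min D \<le> mdist X x y"
    if "x \<in> mspace X" "y \<in> mspace X" for x y
    using Min_le[OF that] mdist_zero[OF that] by auto
  then show ?thesis
    by (rule splittableI[OF pos assms(2)])
qed

lemma compact_metric_finite_approx:
  fixes X :: "real metric"
  assumes X: "compact_metric X" and "0 < r"
  obtains Y :: "real metric"
  where "compact_metric Y" "finite (mspace Y)" "GH_distance X Y < r"
proof -
  interpret Metric_space "mspace X" "mdist X"
    by simp
  have "mtotally_bounded (mspace X)"
    using X unfolding compact_metric_def compact_space_def mtopology_of_def
    by (simp add: compactin_imp_mtotally_bounded)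
  then obtain K where K: "finite K" "K \<subseteq> mspace X" "mspace X \<subseteq> (\<Union>x\<in>K. mball x (r / 2))"
    unfolding mtotally_bounded_def using \<open>0 < r\<close> by (meson half_gt_zero)
  define Y where "Y = submetric X K"
  have Y: "mspace Y = K" "mdist Y = mdist X"
    unfolding Y_def using K(2) by (auto simp: mspace_submetric)
  have "K \<noteq> {}"
    using K(3) X unfolding compact_metric_def by auto
  then have cY: "compact_metric Y"
    unfolding compact_metric_def compact_space_def
    using K(1) Y(1) by (simp add: finite_imp_compactin)
  \<comment> \<open>Pairing points with net points at distance at most \<open>r / 2\<close> gives
    distortion at most \<open>r\<close>, hence Gromov-Hausdorff distance at most
    \<open>r / 2\<close>, strictly below \<open>r\<close>.\<close>
  let ?R = "{(x, y) \<in> mspace X \<times> K. mdist X x y \<le> r / 2}"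
  have "correspondence X Y (2 * (r / 2)) ?R"
  proof (rule correspondenceI)
    show "\<exists>y. (x, y) \<in> ?R" if "x \<in> mspace X" for x
      using that K(3) by (force simp: in_mball mdist_commute)
    show "\<exists>x. (x, y) \<in> ?R" if "y \<in> mspace Y" for y
      using that K(2) Y \<open>0 < r\<close> by (intro exI[of _ y]) auto
    show "\<bar>mdist X x x' - mdist Y y y'\<bar> \<le> 2 * (r / 2)" if "(x, y) \<in> ?R" "(x', y') \<in> ?R" for x y x' y'
    proof -
      have "x \<in> mspace X" "x' \<in> mspace X" "y \<in> mspace X" "y' \<in> mspace X"
        using that K(2) by auto
      then have "mdist X x x' \<le> mdist X x y + mdist X y x'" "mdist X y x' \<le> mdist X y y' + mdist X y' x'"
        "mdist X y y' \<le> mdist X y x + mdist X x y'" "mdist X x y' \<le> mdist X x x' + mdist X x' y'"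
        by (auto intro: mdist_triangle)
      then show ?thesis
        using that Y(2) mdist_commute[of X y x] mdist_commute[of X y' x'] by auto
    qed
  qed (use Y(1) in auto)
  then have "GH_distance X Y \<le> r / 2"
    by (rule GH_distance_le_correspondence[OF X cY half_gt_zero[OF \<open>0 < r\<close>]])
  then show thesis
    using that cY K(1) Y(1) \<open>0 < r\<close> by simp
qed

lemma splittable_imp_totally_discontinuous:
  assumes split: "\<And>n :: nat. splittable (1 / Suc n) X"
  shows "totally_discontinuous (mtopology_of X)"
  unfolding totally_discontinuous_def
proof
  interpret Metric_space "mspace X" "mdist X"
    by simp
  fix C assume C: "C \<in> connected_components_of (mtopology_of X)"
  have conn: "connectedin (mtopology_of X) C"
    using C by (rule connectedin_connected_components_of)
  then have CX: "C \<subseteq> mspace X"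
    using connectedin_subset_topspace by fastforce
  have small: "mdist X x y \<le> 1 / Suc n" if xy: "x \<in> C" "y \<in> C" for x y and n :: nat
  proof -
    obtain d e' and k :: "real \<Rightarrow> real" where d: "0 < d" and e': "e' < 1 / Suc n"
      and k: "\<And>x y. x \<in> mspace X \<Longrightarrow> y \<in> mspace X \<Longrightarrow>
        if k x = k y then mdist X x y \<le> e' else d \<le> mdist X x y"
      using split[of n] unfolding splittable_def by blast
    \<comment> \<open>A ball of radius \<open>d\<close> meets only the colour of its centre, so
      every union of colour classes is open. Stating this for arbitrary \<open>P\<close> covers both
      a class and its complement.\<close>
    have op: "openin (mtopology_of X) {z \<in> mspace X. P (k z)}" for P
      unfolding mtopology_of_def openin_mtopology
    proof (intro conjI strip)
      fix z assume z: "z \<in> {z \<in> mspace X. P (k z)}"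
      have "mball z d \<subseteq> {z \<in> mspace X. P (k z)}"
        using z k[of z] by (fastforce simp: in_mball split: if_splits)
      then show "\<exists>r>0. mball z r \<subseteq> {z \<in> mspace X. P (k z)}"
        using d by blast
    qed auto
    have "k x = k y"
    proof (rule ccontr)
      assume "k x \<noteq> k y"
      have "C \<subseteq> {z \<in> mspace X. k z = k x} \<union> {z \<in> mspace X. k z \<noteq> k x}"
        using CX by auto
      then have "{z \<in> mspace X. k z = k x} \<inter> C = {} \<or> {z \<in> mspace X. k z \<noteq> k x} \<inter> C = {}"
        using connectedinD[OF conn op[of "\<lambda>c. c = k x"] op[of "\<lambda>c. c \<noteq> k x"]] by auto
      then show False
        using xy CX \<open>k x \<noteq> k y\<close> by auto
    qed
    then have "mdist X x y \<le> e'"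
      using k[of x y] xy CX by auto
    with e' show ?thesis
      by linarith
  qed
  have "x = y" if xy: "x \<in> C" "y \<in> C" for x y
  proof (rule ccontr)
    assume "x \<noteq> y"
    then have "0 < mdist X x y"
      using xy CX by (simp add: subset_iff mdist_pos_eq)
    then obtain n where "1 / Suc n < mdist X x y"
      using nat_approx_posE by metis
    with small[OF xy, of n] show False
      by simp
  qed
  moreover have "C \<noteq> {}"
    using C nonempty_connected_components_of by blast
  ultimately show "\<exists>x. C = {x}"
    by blast
qed

lift_definition GH_splittable :: "real \<Rightarrow> GH_space \<Rightarrow> bool" is splittable
proof -
  \<comment> \<open>Isometric spaces are at distance 0, hence within the radius given by
    \<open>splittable_near\<close>.\<close>
  have "splittable e Y"
    if "compact_metric X" "compact_metric Y" "isometric X Y" "splittable e X" for e X Y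
    using splittable_near[OF that(1,4)] isometric_imp_GH_distance_0[OF that(1-3)] that(2) by metis
  then show "splittable e X = splittable e Y"
    if "compact_metric X \<and> compact_metric Y \<and> isometric X Y" for e X Y
    using that isometric_sym by blast
qed

lemma open_GH_splittable: "open {X. GH_splittable e X}"
proof -
  have "\<exists>r>0. \<forall>Y. dist X Y < r \<longrightarrow> GH_splittable e Y" if "GH_splittable e X" for X
    using that
  proof transfer
    fix X :: "real metric" and e
    assume "compact_metric X \<and> compact_metric X \<and> isometric X X" "splittable e X"
    then obtain r where "0 < r"
      "\<And>Y. compact_metric Y \<Longrightarrow> GH_distance X Y < r \<Longrightarrow> splittable e Y"
      using splittable_near by blast
    then show "\<exists>r>0. \<forall>Y\<in>{Y. compact_metric Y \<and> compact_metric Y \<and> isometric Y Y}.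
        GH_distance X Y < r \<longrightarrow> splittable e Y"
      by blast
  qed
  then show ?thesis
    unfolding open_dist by (simp add: dist_commute)
qed

lemma closure_GH_splittable:
  assumes "0 < e"
  shows "closure {X. GH_splittable e X} = UNIV"
proof -
  have "\<exists>Y. GH_splittable e Y \<and> dist X Y < r" if "0 < r" for X r
    using that assms
  proof transfer
    fix r e :: real and X :: "real metric"
    assume "0 < r" "0 < e" "compact_metric X \<and> compact_metric X \<and> isometric X X"
    then obtain Y :: "real metric"
      where "compact_metric Y" "finite (mspace Y)" "GH_distance X Y < r"
      using compact_metric_finite_approx by metis
    then show "\<exists>Y\<in>{Y. compact_metric Y \<and> compact_metric Y \<and> isometric Y Y}. splittable e Y \<and> GH_distance X Y < r"
      using splittable_finite \<open>0 < e\<close> isometric_refl by blast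
  qed
  then show ?thesis
    by (auto simp: closure_approachable dist_commute)
qed

lemma GH_splittable_imp_totally_discontinuous:
  assumes "\<And>n :: nat. GH_splittable (1 / Suc n) X"
  shows "GH_totally_discontinuous X"
  using assms by transfer (rule splittable_imp_totally_discontinuous)

text \<open>The complement of \<open>U\<close> is closed, contains \<open>A\<close>, and has empty
  interior because \<open>U\<close> is dense.\<close>

lemma rare_if_disjoint_open_dense:
  assumes "open U" "closure U = UNIV" "A \<inter> U = {}"
  shows "rare A"
proof -
  have "closure A \<subseteq> - U"
    using assms(1,3) by (intro closure_minimal) auto
  then have "interior (closure A) \<subseteq> interior (- U)"
    by (rule interior_mono)
  then show ?thesis
    unfolding rare_def using assms(2) by (simp add: interior_complement)
qed

theorem theorem1:
  shows "residual {X :: GH_space. GH_totally_discontinuous X}"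
proof -
  let ?U = "\<lambda>n :: nat. {X. GH_splittable (1 / Suc n) X}"
  let ?N = "- {X :: GH_space. GH_totally_discontinuous X}"
  \<comment> \<open>\<open>meager\<close> asks for an exact union of rare sets, so each complement
    of \<open>?U n\<close> is cut down to \<open>?N\<close>.\<close>
  have "rare (?N - ?U n)" for n
    by (rule rare_if_disjoint_open_dense[OF open_GH_splittable closure_GH_splittable]) auto
  moreover have "?N = \<Union> (range (\<lambda>n. ?N - ?U n))"
    using GH_splittable_imp_totally_discontinuous by blast
  ultimately show ?thesis
    unfolding residual_def meager_def
    by (intro exI[of _ "range (\<lambda>n. ?N - ?U n)"] conjI) (blast | simp)+
qed

end
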